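(* Let $X$ be a set with $|X|\geq\aleph_2$, and let $\mathcal{K}_{\triangle}$ denote the class of finite triangle-free graphs. Then $\mathbb{C}_X(\mathcal{K}_{\triangle})\not\simeq\mathbb{C}[X]$, i.e. $\mathbb{C}_X(\mathcal{K}_{\triangle})$ is not forcing equivalent to Cohen forcing over $X$. In particular, $\mathbb{C}_X(\mathcal{K}_{\triangle})$ is not Cohen.
   Context: Graphs are undirected simple graphs, viewed as structures in the language with one binary relation symbol. For a class $\mathcal{K}$ of finite structures in a relational language and an infinite set $X$, $\mathbb{C}_X(\mathcal{K})$ is the partial order whose elements are the structures $\mathcal{A}\in\mathcal{K}$ whose underlying set is a (finite) subset of $X$, ordered by reverse inclusion: $\mathcal{B}\leq\mathcal{A}$ iff $\mathcal{A}$ is a substructure of $\mathcal{B}$ (for graphs: an induced subgraph). Cohen forcing over $X$ is $\mathbb{C}[X]=\{p : p\colon X_0\to 2 \text{ for some finite } X_0\subseteq X\}$, ordered by reverse inclusion. For a partial order $\mathbb{P}$, $\operatorname{RO}(\mathbb{P})$ is the complete Boolean algebra of regular open subsets of $\mathbb{P}$, where the open sets are the downward closed sets. We write $\mathbb{P}\simeq\mathbb{Q}$ (forcing equivalent) when $\operatorname{RO}(\mathbb{P})\cong\operatorname{RO}(\mathbb{Q})$. A partial order $\mathbb{P}$ is called Cohen if $\operatorname{RO}(\mathbb{P})\cong\operatorname{RO}(\mathbb{C}[Z])$ for some infinite set $Z$. *)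

theory Defs
  imports "HOL-Algebra.Order" "HOL-Analysis.Abstract_Topology"
begin

unbundle cardinal_syntax

no_notation eq_closure_of (\<open>closure'_of\<index>\<close>) \<comment> \<open>clashes with topological closure\<close>

section \<open>Regular open algebras and forcing equivalence\<close>

text \<open>Forcing notions are orders in the sense of \<^theory>\<open>HOL-Algebra.Order\<close>, with the
  stronger conditions below the weaker ones.\<close>

definition downset_topology :: "'p gorder \<Rightarrow> 'p topology" where
  "downset_topology P = topology (\<lambda>U. U \<subseteq> carrier P \<and>
     (\<forall>p\<in>U. \<forall>q\<in>carrier P. q \<sqsubseteq>\<^bsub>P\<^esub> p \<longrightarrow> q \<in> U))"

definition RO :: "'p gorder \<Rightarrow> 'p set set" where
  "RO P = {U. openin (downset_topology P) U \<and>
     downset_topology P interior_of (downset_topology P closure_of U) = U}"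

text \<open>The operations of the complete Boolean algebra \<^const>\<open>RO\<close>, whose order is inclusion.
  For the empty family, the infimum is the whole of \<^term>\<open>carrier P\<close>.\<close>

definition RO_Sup :: "'p gorder \<Rightarrow> 'p set set \<Rightarrow> 'p set" where
  "RO_Sup P \<U> = downset_topology P interior_of (downset_topology P closure_of \<Union>\<U>)"

definition RO_Inf :: "'p gorder \<Rightarrow> 'p set set \<Rightarrow> 'p set" where
  "RO_Inf P \<U> = downset_topology P interior_of \<Inter>\<U>"

definition RO_compl :: "'p gorder \<Rightarrow> 'p set \<Rightarrow> 'p set" where
  "RO_compl P U = downset_topology P interior_of (carrier P - U)"

definition RO_iso :: "'p gorder \<Rightarrow> 'q gorder \<Rightarrow> ('p set \<Rightarrow> 'q set) \<Rightarrow> bool" where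
  "RO_iso P Q f \<longleftrightarrow> bij_betw f (RO P) (RO Q) \<and>
     (\<forall>U\<in>RO P. f (RO_compl P U) = RO_compl Q (f U)) \<and>
     (\<forall>\<U>\<subseteq>RO P. f (RO_Sup P \<U>) = RO_Sup Q (f ` \<U>)) \<and>
     (\<forall>\<U>\<subseteq>RO P. f (RO_Inf P \<U>) = RO_Inf Q (f ` \<U>))"

definition forcing_equivalent :: "'p gorder \<Rightarrow> 'q gorder \<Rightarrow> bool" (infix \<open>\<simeq>\<^sub>f\<close> 50) where
  "P \<simeq>\<^sub>f Q \<longleftrightarrow> (\<exists>f. RO_iso P Q f)"


section \<open>Cohen forcing\<close>

definition cohen_forcing :: "'a set \<Rightarrow> ('a \<rightharpoonup> bool) gorder" where
  "cohen_forcing X = \<lparr>carrier = {p. finite (dom p) \<and> dom p \<subseteq> X}, eq = (=),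
     le = (\<lambda>q p. p \<subseteq>\<^sub>m q)\<rparr>"

text \<open>HOL cannot quantify over types inside a formula, so the type from which the
  infinite set is taken is a parameter. Being Cohen means satisfying this predicate for
  some type; not being Cohen means failing it for every type.\<close>

definition is_cohen :: "'b itself \<Rightarrow> 'p gorder \<Rightarrow> bool" where
  "is_cohen (_ :: 'b itself) P \<longleftrightarrow> (\<exists>Z :: 'b set. infinite Z \<and> P \<simeq>\<^sub>f cohen_forcing Z)"


section \<open>Forcing with finite structures\<close>

text \<open>A structure for one binary relation symbol: its underlying set and its relation.\<close>

type_synonym 'a binstr = "'a set \<times> ('a \<times> 'a) set"

definition substructure :: "'a binstr \<Rightarrow> 'a binstr \<Rightarrow> bool" where
  "substructure A B \<longleftrightarrow> fst A \<subseteq> fst B \<and> snd A = snd B \<inter> (fst A \<times> fst A)"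

definition structure_forcing :: "'a set \<Rightarrow> 'a binstr set \<Rightarrow> 'a binstr gorder" where
  "structure_forcing X K = \<lparr>carrier = {A \<in> K. fst A \<subseteq> X}, eq = (=),
     le = (\<lambda>B A. substructure A B)\<rparr>"

definition is_graph :: "'a binstr \<Rightarrow> bool" where
  "is_graph A \<longleftrightarrow> snd A \<subseteq> fst A \<times> fst A \<and> sym (snd A) \<and> irrefl (snd A)"

definition triangle_free :: "'a binstr \<Rightarrow> bool" where
  "triangle_free A \<longleftrightarrow>
     \<not> (\<exists>a b c. (a, b) \<in> snd A \<and> (b, c) \<in> snd A \<and> (a, c) \<in> snd A)"

definition triangle_free_graphs :: "'a binstr set" (\<open>\<K>\<^sub>\<triangle>\<close>) where
  "\<K>\<^sub>\<triangle> = {A. is_graph A \<and> finite (fst A) \<and> triangle_free A}"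


section \<open>Basic facts\<close>

lemma partial_order_cohen_forcing: "partial_order (cohen_forcing X)"
  by unfold_locales
     (auto simp: cohen_forcing_def intro: map_le_antisym map_le_trans)

lemma partial_order_structure_forcing:
  assumes "K \<subseteq> Collect is_graph"
  shows "partial_order (structure_forcing X K)"
proof -
  have "snd A \<subseteq> fst A \<times> fst A" if "A \<in> K" for A
    using subsetD[OF assms that] by (simp add: is_graph_def)
  then have "substructure A A" if "A \<in> K" for A
    using that unfolding substructure_def by blast
  moreover have "A = B" if "substructure A B" "substructure B A" for A B :: "'a binstr"
    using that unfolding substructure_def prod_eq_iff by blast
  moreover have "substructure A C" if "substructure A B" "substructure B C" for A B C :: "'a binstr"
    using that unfolding substructure_def by auto
  ultimately show ?thesis
    by unfold_locales (auto simp: structure_forcing_def)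
qed

lemma openin_downset_topology:
  "openin (downset_topology P) U \<longleftrightarrow>
     U \<subseteq> carrier P \<and> (\<forall>p\<in>U. \<forall>q\<in>carrier P. q \<sqsubseteq>\<^bsub>P\<^esub> p \<longrightarrow> q \<in> U)"
proof -
  have "istopology (\<lambda>U. U \<subseteq> carrier P \<and> (\<forall>p\<in>U. \<forall>q\<in>carrier P. q \<sqsubseteq>\<^bsub>P\<^esub> p \<longrightarrow> q \<in> U))"
    unfolding istopology_def by blast
  then show ?thesis
    unfolding downset_topology_def by (simp add: topology_inverse')
qed

lemma topspace_downset_topology [simp]: "topspace (downset_topology P) = carrier P"
proof
  show "topspace (downset_topology P) \<subseteq> carrier P"
    using openin_topspace[of "downset_topology P"] unfolding openin_downset_topology by simp
  show "carrier P \<subseteq> topspace (downset_topology P)"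
    by (rule openin_subset) (simp add: openin_downset_topology)
qed

context
  fixes P :: "'p gorder" and T
  defines "T \<equiv> downset_topology P"
begin

lemma RO_interior_closure: "T interior_of (T closure_of S) \<in> RO P"
proof -
  have "T interior_of (T closure_of (T interior_of (T closure_of S))) \<subseteq> T interior_of (T closure_of S)"
    by (intro interior_of_mono closure_of_minimal interior_of_subset closedin_closure_of)
  moreover have "T interior_of (T closure_of S) \<subseteq> T interior_of (T closure_of (T interior_of (T closure_of S)))"
    by (intro interior_of_maximal closure_of_subset interior_of_subset_topspace openin_interior_of)
  ultimately show ?thesis
    unfolding RO_def T_def by auto
qed

lemma RO_D: "U \<in> RO P \<Longrightarrow> openin T U" "U \<in> RO P \<Longrightarrow> T interior_of (T closure_of U) = U"
  "U \<in> RO P \<Longrightarrow> U \<subseteq> carrier P"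
  unfolding RO_def T_def using openin_subset[of "downset_topology P" U] by auto

lemma RO_Sup_closed: "RO_Sup P \<U> \<in> RO P"
  using RO_interior_closure[of "\<Union>\<U>"] unfolding RO_Sup_def T_def .

lemma RO_Sup_upper: "\<U> \<subseteq> RO P \<Longrightarrow> U \<in> \<U> \<Longrightarrow> U \<subseteq> RO_Sup P \<U>"
  using RO_D(2)[of U] interior_of_mono[OF closure_of_mono[OF Union_upper[of U \<U>]], of T T]
  unfolding RO_Sup_def T_def by auto

lemma RO_Sup_least: "V \<in> RO P \<Longrightarrow> (\<And>U. U \<in> \<U> \<Longrightarrow> U \<subseteq> V) \<Longrightarrow> RO_Sup P \<U> \<subseteq> V"
  using RO_D(2)[of V] interior_of_mono[OF closure_of_mono[OF Union_least[of \<U> V]], of T T]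
  unfolding RO_Sup_def T_def by auto

lemma RO_Inf_closed:
  assumes "\<U> \<subseteq> RO P"
  shows "RO_Inf P \<U> \<in> RO P"
proof -
  let ?I = "T interior_of \<Inter>\<U>"
  have "T interior_of (T closure_of ?I) \<subseteq> U" if "U \<in> \<U>" for U
  proof -
    have "?I \<subseteq> U"
      using interior_of_subset[of T "\<Inter>\<U>"] that by blast
    then show ?thesis
      using interior_of_mono[OF closure_of_mono, of ?I U T T] RO_D(2)[of U] that assms by blast
  qed
  then have "T interior_of (T closure_of ?I) \<subseteq> ?I"
    by (intro interior_of_maximal) auto
  moreover have "?I \<subseteq> T interior_of (T closure_of ?I)"
    by (intro interior_of_maximal closure_of_subset interior_of_subset_topspace openin_interior_of)
  ultimately show ?thesis
    unfolding RO_def RO_Inf_def T_def by auto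
qed

lemma RO_Inf_lower: "U \<in> \<U> \<Longrightarrow> RO_Inf P \<U> \<subseteq> U"
  using interior_of_subset[of T "\<Inter>\<U>"] unfolding RO_Inf_def T_def by blast

lemma RO_Inf_greatest: "V \<in> RO P \<Longrightarrow> (\<And>U. U \<in> \<U> \<Longrightarrow> V \<subseteq> U) \<Longrightarrow> V \<subseteq> RO_Inf P \<U>"
  using interior_of_maximal[OF Inter_greatest[of \<U> V], of T] RO_D(1)[of V]
  unfolding RO_Inf_def T_def by auto

lemma RO_compl_closed:
  assumes "U \<in> RO P"
  shows "RO_compl P U \<in> RO P"
proof -
  have "closedin T (carrier P - U)"
    using RO_D(1)[OF assms] unfolding T_def by (metis openin_closedin_eq topspace_downset_topology)
  then show ?thesis
    using RO_interior_closure[of "carrier P - U"]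
    unfolding RO_compl_def T_def by (simp add: closure_of_closedin)
qed

lemma RO_subset_compl_iff:
  assumes "U \<in> RO P" "V \<in> RO P"
  shows "V \<subseteq> RO_compl P U \<longleftrightarrow> U \<inter> V = {}"
  using interior_of_maximal_eq[OF RO_D(1)[OF assms(2)], of "carrier P - U"] RO_D(3)[OF assms(2)]
  unfolding RO_compl_def T_def by blast

lemma RO_Int_closed: "U \<in> RO P \<Longrightarrow> V \<in> RO P \<Longrightarrow> U \<inter> V \<in> RO P"
  using RO_Inf_closed[of "{U, V}"] RO_D(1)[of U] RO_D(1)[of V]
  unfolding RO_Inf_def T_def by (simp add: interior_of_openin openin_Int)

end

lemma RO_empty: "{} \<in> RO P"
  unfolding RO_def by simp

text \<open>Preserving the operations of the Boolean algebra amounts to being an order isomorphism.\<close>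

lemma RO_iso_iff_order_iso:
  "RO_iso P Q f \<longleftrightarrow>
     bij_betw f (RO P) (RO Q) \<and> (\<forall>U\<in>RO P. \<forall>V\<in>RO P. U \<subseteq> V \<longleftrightarrow> f U \<subseteq> f V)"
    (is "_ \<longleftrightarrow> ?R")
proof
  assume iso: "RO_iso P Q f"
  then have bij: "bij_betw f (RO P) (RO Q)"
    unfolding RO_iso_def by blast
  have Int: "f (U \<inter> V) = f U \<inter> f V" if "U \<in> RO P" "V \<in> RO P" for U V
  proof -
    have "f U \<in> RO Q" "f V \<in> RO Q"
      using that bij by (auto simp: bij_betw_def)
    moreover have "f (RO_Inf P {U, V}) = RO_Inf Q (f ` {U, V})"
      using iso that unfolding RO_iso_def by (meson empty_subsetI insert_subset)
    ultimately show ?thesis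
      using that RO_D(1)[OF that(1)] RO_D(1)[OF that(2)] RO_D(1)[of "f U" Q] RO_D(1)[of "f V" Q]
      by (simp add: RO_Inf_def interior_of_openin openin_Int)
  qed
  have "U \<subseteq> V \<longleftrightarrow> f U \<subseteq> f V" if "U \<in> RO P" "V \<in> RO P" for U V
  proof -
    have "U \<subseteq> V \<longleftrightarrow> U \<inter> V = U"
      by blast
    also have "\<dots> \<longleftrightarrow> f (U \<inter> V) = f U"
      using inj_on_eq_iff[OF bij_betw_imp_inj_on[OF bij] RO_Int_closed[OF that] that(1)] by simp
    also have "\<dots> \<longleftrightarrow> f U \<subseteq> f V"
      using Int[OF that] by blast
    finally show ?thesis .
  qed
  with bij show ?R
    by blast
next
  assume R: ?R
  then have bij: "bij_betw f (RO P) (RO Q)" and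
    mono: "\<And>U V. U \<in> RO P \<Longrightarrow> V \<in> RO P \<Longrightarrow> f U \<subseteq> f V \<longleftrightarrow> U \<subseteq> V"
    by simp_all
  have mem: "f U \<in> RO Q" if "U \<in> RO P" for U
    using that bij by (auto simp: bij_betw_def)
  have sub_mem: "f ` \<U> \<subseteq> RO Q" if "\<U> \<subseteq> RO P" for \<U>
    using mem[OF subsetD[OF that]] by (rule image_subsetI)
  obtain g where g: "\<And>W. W \<in> RO Q \<Longrightarrow> g W \<in> RO P" "\<And>W. W \<in> RO Q \<Longrightarrow> f (g W) = W"
    using bij by (metis bij_betw_def f_inv_into_f inv_into_into)
  have Sup: "f (RO_Sup P \<U>) = RO_Sup Q (f ` \<U>)" if sub: "\<U> \<subseteq> RO P" for \<U>
  proof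
    let ?W = "g (RO_Sup Q (f ` \<U>))"
    note W = g[OF RO_Sup_closed[of Q "f ` \<U>"]]
    have "U \<subseteq> ?W" if "U \<in> \<U>" for U
      using mono[OF subsetD[OF sub that] W(1)] W(2)
        RO_Sup_upper[OF sub_mem[OF sub] imageI[OF that]] by simp
    then show "f (RO_Sup P \<U>) \<subseteq> RO_Sup Q (f ` \<U>)"
      using mono[OF RO_Sup_closed W(1)] W(2) RO_Sup_least[OF W(1)] by simp
    show "RO_Sup Q (f ` \<U>) \<subseteq> f (RO_Sup P \<U>)"
    proof (rule RO_Sup_least[OF mem[OF RO_Sup_closed]])
      fix V assume "V \<in> f ` \<U>"
      then obtain U where U: "U \<in> \<U>" "V = f U"
        by (rule imageE)
      then show "V \<subseteq> f (RO_Sup P \<U>)"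
        using mono[OF subsetD[OF sub U(1)] RO_Sup_closed] RO_Sup_upper[OF sub U(1)] by simp
    qed
  qed
  have Inf: "f (RO_Inf P \<U>) = RO_Inf Q (f ` \<U>)" if sub: "\<U> \<subseteq> RO P" for \<U>
  proof
    let ?W = "g (RO_Inf Q (f ` \<U>))"
    note W = g[OF RO_Inf_closed[OF sub_mem[OF sub]]]
    have "?W \<subseteq> U" if "U \<in> \<U>" for U
      using mono[OF W(1) subsetD[OF sub that]] W(2) RO_Inf_lower[OF imageI[OF that, of f], of Q]
      by simp
    then show "RO_Inf Q (f ` \<U>) \<subseteq> f (RO_Inf P \<U>)"
      using mono[OF W(1) RO_Inf_closed[OF sub]] W(2) RO_Inf_greatest[OF W(1)] by simp
    show "f (RO_Inf P \<U>) \<subseteq> RO_Inf Q (f ` \<U>)"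
    proof (rule RO_Inf_greatest[OF mem[OF RO_Inf_closed[OF sub]]])
      fix V assume "V \<in> f ` \<U>"
      then obtain U where U: "U \<in> \<U>" "V = f U"
        by (rule imageE)
      then show "f (RO_Inf P \<U>) \<subseteq> V"
        using mono[OF RO_Inf_closed[OF sub] subsetD[OF sub U(1)]] RO_Inf_lower[OF U(1)] by simp
    qed
  qed
  have empty: "f {} = {}"
    using mono[OF RO_empty g(1)[OF RO_empty]] g(2)[OF RO_empty] by simp
  have Int: "f (U \<inter> V) = f U \<inter> f V" if U: "U \<in> RO P" and V: "V \<in> RO P" for U V
  proof -
    have "RO_Inf P {U, V} = U \<inter> V" "RO_Inf Q {f U, f V} = f U \<inter> f V"
      using RO_D(1)[OF U] RO_D(1)[OF V] RO_D(1)[OF mem[OF U]] RO_D(1)[OF mem[OF V]]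
      by (simp_all add: RO_Inf_def interior_of_openin openin_Int)
    then show ?thesis
      using Inf[of "{U, V}"] U V by simp
  qed
  have disj: "f U \<inter> f V = {} \<longleftrightarrow> U \<inter> V = {}" if U: "U \<in> RO P" and V: "V \<in> RO P" for U V
    using mono[OF RO_Int_closed[OF U V] RO_empty] empty Int[OF U V] by simp
  have compl: "f (RO_compl P U) = RO_compl Q (f U)" if U: "U \<in> RO P" for U
  proof
    note cU = RO_compl_closed[OF U]
    show "f (RO_compl P U) \<subseteq> RO_compl Q (f U)"
      using RO_subset_compl_iff[OF mem[OF U] mem[OF cU]] disj[OF U cU]
        RO_subset_compl_iff[OF U cU] by simp
    note W = g[OF RO_compl_closed[OF mem[OF U]]]
    show "RO_compl Q (f U) \<subseteq> f (RO_compl P U)"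
      using RO_subset_compl_iff[OF mem[OF U] mem[OF W(1)]] disj[OF U W(1)]
        RO_subset_compl_iff[OF U W(1)] mono[OF W(1) cU] W(2) by simp
  qed
  show "RO_iso P Q f"
    unfolding RO_iso_def using bij Sup Inf compl by simp
qed

end

theory Submission
  imports Defs "HOL-Library.Countable_Set_Type"
begin

text \<open>In Cohen forcing, the conditions supported by \<open>S\<close> and those supported by \<open>T\<close> together
  generate the conditions supported by \<open>S \<union> T\<close>, a regular subalgebra. For triangle-free graphs
  this fails: no pair of compatible graphs on vertex sets inside \<open>Y\<close> and \<open>Y'\<close> guarantees that
  \<open>x \<in> Y - Y'\<close> and \<open>y \<in> Y' - Y\<close> can still be joined, because the two graphs can be extended by
  a common new neighbour \<open>z \<in> Y \<inter> Y'\<close> of \<open>x\<close> and \<open>y\<close>. Given an isomorphism of the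
  regular open algebras, countable vertex sets can be closed off so that they match countable
  subsets of the Cohen index set. Two such sets \<open>Y\<close>, \<open>Y'\<close> that are incomparable and have infinite
  intersection exist because a set mapping with countable values on at least \<open>\<aleph>\<^sub>2\<close> points
  has a free pair.\<close>

section \<open>Regular open sets in terms of the order\<close>

locale forcing_notion = partial_order P for P :: "'p gorder" (structure)
begin

lemma interior_of_downset_topology:
  "downset_topology P interior_of S = {p \<in> carrier P. \<forall>q\<in>carrier P. q \<sqsubseteq> p \<longrightarrow> q \<in> S}"
    (is "_ = ?I")
proof
  let ?T = "downset_topology P"
  have "?T interior_of S \<subseteq> carrier P" "?T interior_of S \<subseteq> S"
    using interior_of_subset_topspace[of ?T S] interior_of_subset[of ?T S] by auto
  moreover have "openin ?T (?T interior_of S)"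
    by simp
  ultimately show "?T interior_of S \<subseteq> ?I"
    unfolding openin_downset_topology by blast
  have "openin ?T ?I"
    unfolding openin_downset_topology by (auto intro: le_trans)
  then show "?I \<subseteq> ?T interior_of S"
    by (rule interior_of_maximal[rotated]) auto
qed

lemma closure_of_downset_topology:
  "downset_topology P closure_of S = {p \<in> carrier P. \<exists>q\<in>carrier P. q \<sqsubseteq> p \<and> q \<in> S}"
  by (auto simp: closure_of_interior_of interior_of_downset_topology)

lemma mem_RO_iff:
  "U \<in> RO P \<longleftrightarrow> U \<subseteq> carrier P \<and> (\<forall>p\<in>U. \<forall>q\<in>carrier P. q \<sqsubseteq> p \<longrightarrow> q \<in> U) \<and>
     (\<forall>p\<in>carrier P. (\<forall>q\<in>carrier P. q \<sqsubseteq> p \<longrightarrow> (\<exists>r\<in>carrier P. r \<sqsubseteq> q \<and> r \<in> U)) \<longrightarrow> p \<in> U)"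
  unfolding RO_def interior_of_downset_topology closure_of_downset_topology openin_downset_topology
  by (auto simp: set_eq_iff)

lemma RO_down: "U \<in> RO P \<Longrightarrow> p \<in> U \<Longrightarrow> q \<in> carrier P \<Longrightarrow> q \<sqsubseteq> p \<Longrightarrow> q \<in> U"
  unfolding mem_RO_iff by blast

lemma RO_denseI:
  "U \<in> RO P \<Longrightarrow> p \<in> carrier P \<Longrightarrow>
    (\<And>q. q \<in> carrier P \<Longrightarrow> q \<sqsubseteq> p \<Longrightarrow> \<exists>r\<in>carrier P. r \<sqsubseteq> q \<and> r \<in> U) \<Longrightarrow> p \<in> U"
  unfolding mem_RO_iff by blast

text \<open>The regular open hull of a condition. It can be larger than the set of conditions
  below \<open>p\<close>: triangle-free graphs are not separative, as isolated vertices carry no information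
  in the regular open algebra.\<close>

definition cone :: "'p \<Rightarrow> 'p set" where
  "cone p = {q \<in> carrier P. \<forall>r\<in>carrier P. r \<sqsubseteq> q \<longrightarrow> (\<exists>s\<in>carrier P. s \<sqsubseteq> r \<and> s \<sqsubseteq> p)}"

lemma cone_carrier: "cone p \<subseteq> carrier P"
  unfolding cone_def by blast

lemma cone_in_RO:
  assumes "p \<in> carrier P"
  shows "cone p \<in> RO P"
proof -
  have "q \<in> cone p" if q: "q \<in> carrier P"
    and d: "\<And>r. r \<in> carrier P \<Longrightarrow> r \<sqsubseteq> q \<Longrightarrow> \<exists>s\<in>carrier P. s \<sqsubseteq> r \<and> s \<in> cone p" for q
  proof -
    have "\<exists>s\<in>carrier P. s \<sqsubseteq> r \<and> s \<sqsubseteq> p" if r: "r \<in> carrier P" "r \<sqsubseteq> q" for r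
    proof -
      obtain s where s: "s \<in> carrier P" "s \<sqsubseteq> r" "s \<in> cone p"
        using d[OF r] by blast
      then obtain t where "t \<in> carrier P" "t \<sqsubseteq> s" "t \<sqsubseteq> p"
        unfolding cone_def using le_refl by blast
      with s r show ?thesis
        using le_trans by blast
    qed
    with q show ?thesis
      unfolding cone_def by blast
  qed
  moreover have "r \<in> cone p" if "q \<in> cone p" "r \<in> carrier P" "r \<sqsubseteq> q" for q r
    using that unfolding cone_def by (auto intro: le_trans)
  ultimately show ?thesis
    unfolding mem_RO_iff using cone_carrier by blast
qed

lemma cone_self: "p \<in> carrier P \<Longrightarrow> p \<in> cone p"
  unfolding cone_def by (auto intro: le_refl)

text \<open>Below any \<open>q\<close> in \<open>cone p\<close> the common extensions with
  \<open>p\<close> are dense, and openness puts them into \<open>U\<close>; regularity then gives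
  \<open>q\<close>. With \<open>cone_in_RO\<close> and \<open>cone_self\<close> this makes
  \<open>cone p\<close> the least regular open set containing the condition
  \<open>p\<close>.\<close>

lemma cone_subset:
  assumes "U \<in> RO P" "p \<in> U"
  shows "cone p \<subseteq> U"
proof
  fix q assume q: "q \<in> cone p"
  show "q \<in> U"
  proof (rule RO_denseI[OF assms(1)])
    show "q \<in> carrier P"
      using q by (simp add: cone_def)
    fix r assume "r \<in> carrier P" "r \<sqsubseteq> q"
    then obtain s where "s \<in> carrier P" "s \<sqsubseteq> r" "s \<sqsubseteq> p"
      using q unfolding cone_def by blast
    then show "\<exists>s\<in>carrier P. s \<sqsubseteq> r \<and> s \<in> U"
      using RO_down[OF assms] by blast
  qed
qed

lemma cone_mono: "p \<in> carrier P \<Longrightarrow> q \<in> carrier P \<Longrightarrow> p \<sqsubseteq> q \<Longrightarrow> cone p \<subseteq> cone q"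
  by (intro cone_subset cone_in_RO RO_down[of "cone q" q p] cone_self)

lemma cone_refine:
  assumes "q \<in> cone p" "p \<in> carrier P"
  obtains s where "s \<in> carrier P" "s \<sqsubseteq> q" "s \<sqsubseteq> p"
  using assms unfolding cone_def by (blast intro: le_refl)

end

section \<open>Meets and the empty set under a regular open isomorphism\<close>

lemma RO_iso_Int:
  assumes "RO_iso P Q f" "U \<in> RO P" "V \<in> RO P"
  shows "f (U \<inter> V) = f U \<inter> f V"
proof -
  have mem: "f U \<in> RO Q" "f V \<in> RO Q"
    using assms unfolding RO_iso_def bij_betw_def by auto
  have "f (RO_Inf P {U, V}) = RO_Inf Q (f ` {U, V})"
    using assms unfolding RO_iso_def by (meson empty_subsetI insert_subset)
  then show ?thesis
    using RO_D(1)[OF assms(2)] RO_D(1)[OF assms(3)] RO_D(1)[OF mem(1)] RO_D(1)[OF mem(2)]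
    by (simp add: RO_Inf_def interior_of_openin openin_Int)
qed

text \<open>On both sides \<open>{}\<close> is the supremum of the empty family.\<close>

lemma RO_iso_empty:
  assumes "RO_iso P Q f"
  shows "f {} = {}"
proof -
  have "RO_Sup P {} = {}" "RO_Sup Q {} = {}"
    by (simp_all add: RO_Sup_def)
  then show ?thesis
    using assms unfolding RO_iso_def by (metis empty_subsetI image_empty)
qed

section \<open>Countable supports\<close>

text \<open>A countable set has only countably many finite subsets, so each closure step stays
  countable. Omega steps suffice: a finite subset of the increasing union already lies in one
  stage.\<close>

lemma countable_finitary_closure:
  fixes F :: "'c set \<Rightarrow> 'c set"
  assumes "\<And>s. finite s \<Longrightarrow> countable (F s)" "countable T"
  shows "\<exists>T'. countable T' \<and> T \<subseteq> T' \<and> (\<forall>s. finite s \<and> s \<subseteq> T' \<longrightarrow> F s \<subseteq> T')"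
proof (intro exI conjI allI impI)
  define step where "step = (\<lambda>T. T \<union> (\<Union>s\<in>{s. finite s \<and> s \<subseteq> T}. F s))"
  define C where "C n = (step ^^ n) T" for n
  have C_Suc: "C (Suc n) = step (C n)" for n
    by (simp add: C_def)
  have count: "countable (C n)" for n
  proof (induction n)
    case 0
    then show ?case
      by (simp add: C_def assms)
  next
    case (Suc n)
    have "countable {s. finite s \<and> s \<subseteq> C n}"
      by (rule countable_Collect_finite_subset[OF Suc.IH])
    then show ?case
      unfolding C_Suc step_def using Suc.IH assms(1) by (intro countable_Un countable_UN) auto
  qed
  then show "countable (\<Union>n. C n)"
    by simp
  show "T \<subseteq> (\<Union>n. C n)"
    by (rule order_trans[OF _ UN_upper[of 0]]) (simp_all add: C_def)
  fix s assume "finite s \<and> s \<subseteq> (\<Union>n. C n)"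
  then have s: "finite s" "s \<subseteq> (\<Union>n. C n)"
    by simp_all
  have mono: "mono C"
    unfolding mono_iff_le_Suc C_Suc step_def by blast
  have "\<exists>n. s \<subseteq> C n"
    using s
  proof (induction s)
    case (insert x s)
    then obtain m n where "s \<subseteq> C m" "x \<in> C n"
      by blast
    then have "insert x s \<subseteq> C (max m n)"
      using monoD[OF mono, of m "max m n"] monoD[OF mono, of n "max m n"] by auto
    then show ?case
      by blast
  qed simp
  then obtain n where "s \<subseteq> C n"
    by blast
  then have "F s \<subseteq> C (Suc n)"
    unfolding C_Suc step_def using s(1) by blast
  then show "F s \<subseteq> (\<Union>n. C n)"
    by blast
qed

text \<open>Common setting for Cohen conditions and triangle-free graphs. The axiom
  \<open>amalgamation\<close> says that \<open>res S p\<close> is a reduction of \<open>p\<close>: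
  whatever extends it within \<open>S\<close> remains compatible with \<open>p\<close>, so the
  conditions living on \<open>S\<close> form a complete suborder.\<close>

locale restriction_system = forcing_notion P for P :: "'p gorder" (structure) +
  fixes supp :: "'p \<Rightarrow> 'i set" and res :: "'i set \<Rightarrow> 'p \<Rightarrow> 'p"
  assumes finite_supp: "p \<in> carrier P \<Longrightarrow> finite (supp p)"
    and countable_conditions: "finite S \<Longrightarrow> countable {p \<in> carrier P. supp p \<subseteq> S}"
    and res_closed: "p \<in> carrier P \<Longrightarrow> res S p \<in> carrier P"
    and supp_res: "p \<in> carrier P \<Longrightarrow> supp (res S p) \<subseteq> S"
    and res_id: "p \<in> carrier P \<Longrightarrow> supp p \<subseteq> S \<Longrightarrow> res S p = p"
    and res_mono: "p \<in> carrier P \<Longrightarrow> q \<in> carrier P \<Longrightarrow> q \<sqsubseteq> p \<Longrightarrow> res S q \<sqsubseteq> res S p"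
    and res_antimono: "p \<in> carrier P \<Longrightarrow> S \<subseteq> T \<Longrightarrow> res T p \<sqsubseteq> res S p"
    and amalgamation: "p \<in> carrier P \<Longrightarrow> q \<in> carrier P \<Longrightarrow> supp q \<subseteq> S \<Longrightarrow> q \<sqsubseteq> res S p \<Longrightarrow>
      \<exists>r\<in>carrier P. r \<sqsubseteq> p \<and> r \<sqsubseteq> q"
begin

lemma le_res: "p \<in> carrier P \<Longrightarrow> p \<sqsubseteq> res S p"
  using res_antimono[of p S UNIV] res_id[of p UNIV] by simp

text \<open>Since a condition \<open>p\<close> lies below \<open>res S p\<close>, for regular open
  \<open>U\<close> membership of the two in \<open>U\<close> is then equivalent, so \<open>U\<close>
  is determined by its members living on \<open>S\<close>.\<close>

definition supports :: "'i set \<Rightarrow> 'p set \<Rightarrow> bool" where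
  "supports S U \<longleftrightarrow> (\<forall>p\<in>U. res S p \<in> U)"

lemma supports_mono:
  assumes "U \<in> RO P" "supports S U" "S \<subseteq> T"
  shows "supports T U"
  unfolding supports_def
proof
  fix p assume p: "p \<in> U"
  then have "p \<in> carrier P"
    using RO_D(3)[OF assms(1)] by blast
  with p assms show "res T p \<in> U"
    by (auto simp: supports_def intro: RO_down res_closed res_antimono)
qed

text \<open>A Loewenheim--Skolem argument replaces the usual appeal to the countable chain
  condition: it suffices that below every condition living on \<open>S\<close> that is compatible with \<open>U\<close>
  there is a member of \<open>U\<close> living on \<open>S\<close>.\<close>

lemma ex_countable_support:
  assumes U: "U \<in> RO P"
  obtains S where "countable S" "supports S U"
proof -
  define pick where "pick p = (SOME u. u \<in> U \<and> u \<sqsubseteq> p)" for p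
  define F where
    "F s = (\<Union>p\<in>{p \<in> {p \<in> carrier P. supp p \<subseteq> s}. \<exists>u. u \<in> U \<and> u \<sqsubseteq> p}. supp (pick p))" for s
  have pick: "pick p \<in> U \<and> pick p \<sqsubseteq> p" if "u \<in> U" "u \<sqsubseteq> p" for u p
    unfolding pick_def by (rule someI[of _ u]) (use that in blast)
  have U_carrier: "u \<in> carrier P" if "u \<in> U" for u
    using RO_D(3)[OF U] that by blast
  have cF: "countable (F s)" if "finite s" for s
    unfolding F_def
  proof (rule countable_UN)
    show "countable {p \<in> {p \<in> carrier P. supp p \<subseteq> s}. \<exists>u. u \<in> U \<and> u \<sqsubseteq> p}"
      by (rule countable_subset[OF _ countable_conditions[OF that]]) blast
    fix p assume "p \<in> {p \<in> {p \<in> carrier P. supp p \<subseteq> s}. \<exists>u. u \<in> U \<and> u \<sqsubseteq> p}"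
    then have "pick p \<in> U"
      using pick by blast
    then show "countable (supp (pick p))"
      by (intro countable_finite finite_supp U_carrier)
  qed
  have "\<exists>S. countable S \<and> {} \<subseteq> S \<and> (\<forall>s. finite s \<and> s \<subseteq> S \<longrightarrow> F s \<subseteq> S)"
    by (intro countable_finitary_closure cF countable_empty)
  then obtain S where S: "countable S" "\<And>s. finite s \<Longrightarrow> s \<subseteq> S \<Longrightarrow> F s \<subseteq> S"
    by metis
  have inside: "\<exists>u\<in>U. u \<sqsubseteq> p \<and> supp u \<subseteq> S"
    if "p \<in> carrier P" "supp p \<subseteq> S" "u \<in> U" "u \<sqsubseteq> p" for u p
  proof -
    have "supp (pick p) \<subseteq> F (supp p)"
      unfolding F_def by (rule UN_upper) (use that in auto)
    also have "\<dots> \<subseteq> S"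
      by (rule S(2)[OF finite_supp[OF that(1)] that(2)])
    finally show ?thesis
      using pick[OF that(3,4)] by auto
  qed
  have "res S p \<in> U" if p: "p \<in> U" for p
  proof (rule RO_denseI[OF U])
    note pc = U_carrier[OF p]
    show "res S p \<in> carrier P"
      by (rule res_closed[OF pc])
    fix q assume q: "q \<in> carrier P" "q \<sqsubseteq> res S p"
    \<comment> \<open>The trace of \<open>q\<close> on \<open>S\<close> is compatible with
      \<open>p\<close>, hence with \<open>U\<close>; \<open>inside\<close> replaces the witness by
      one living on \<open>S\<close>, and that one amalgamates with \<open>q\<close> itself.\<close>
    have "res S q \<sqsubseteq> res S (res S p)"
      by (intro res_mono res_closed q pc)
    then have "res S q \<sqsubseteq> res S p"
      using res_id[of "res S p" S] res_closed[OF pc] supp_res[OF pc] by simp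
    then obtain s where s: "s \<in> carrier P" "s \<sqsubseteq> p" "s \<sqsubseteq> res S q"
      using amalgamation[OF pc res_closed[OF q(1)] supp_res[OF q(1)]] by blast
    have "s \<in> U"
      using RO_down[OF U p] s by blast
    then obtain u where u: "u \<in> U" "u \<sqsubseteq> res S q" "supp u \<subseteq> S"
      using inside[of "res S q" s] s res_closed[OF q(1)] supp_res[OF q(1)] by blast
    then obtain r where "r \<in> carrier P" "r \<sqsubseteq> q" "r \<sqsubseteq> u"
      using amalgamation[OF q(1) U_carrier[OF u(1)]] by blast
    then show "\<exists>r\<in>carrier P. r \<sqsubseteq> q \<and> r \<in> U"
      using RO_down[OF U u(1)] by blast
  qed
  with S(1) show thesis
    using that unfolding supports_def by blast
qed

end

text \<open>Both index sets are closed off simultaneously, as one subset of a disjoint sum.\<close>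

lemma ex_matching_supports:
  fixes P :: "'p gorder" and Q :: "'q gorder"
    and suppP :: "'p \<Rightarrow> 'i set" and suppQ :: "'q \<Rightarrow> 'j set"
  assumes P: "restriction_system P suppP resP" and Q: "restriction_system Q suppQ resQ"
    and "\<And>p. p \<in> carrier P \<Longrightarrow> f p \<in> RO Q" and "\<And>q. q \<in> carrier Q \<Longrightarrow> g q \<in> RO P"
    and W: "countable W"
  obtains Y S where "countable Y" "W \<subseteq> Y"
    "\<And>p. p \<in> carrier P \<Longrightarrow> suppP p \<subseteq> Y \<Longrightarrow> restriction_system.supports resQ S (f p)"
    "\<And>q. q \<in> carrier Q \<Longrightarrow> suppQ q \<subseteq> S \<Longrightarrow> restriction_system.supports resP Y (g q)"
proof -
  interpret P: restriction_system P suppP resP by (rule P)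
  interpret Q: restriction_system Q suppQ resQ by (rule Q)
  have "\<exists>S. countable S \<and> Q.supports S (f p)" if "p \<in> carrier P" for p
    using Q.ex_countable_support assms(3)[OF that] by metis
  then obtain a where a: "\<And>p. p \<in> carrier P \<Longrightarrow> countable (a p) \<and> Q.supports (a p) (f p)"
    by metis
  have "\<exists>S. countable S \<and> P.supports S (g q)" if "q \<in> carrier Q" for q
    using P.ex_countable_support assms(4)[OF that] by metis
  then obtain b where b: "\<And>q. q \<in> carrier Q \<Longrightarrow> countable (b q) \<and> P.supports (b q) (g q)"
    by metis
  \<comment> \<open>A finite \<open>s\<close> calls for supports on the opposite side, through
    \<open>a\<close> from left to right and through \<open>b\<close> from right to left. Supports of
    conditions being finite, every condition living on the closed set is met at some finite
    \<open>s\<close>.\<close>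
  define F :: "('i + 'j) set \<Rightarrow> ('i + 'j) set" where
    "F s = (\<Union>p\<in>{p \<in> carrier P. suppP p \<subseteq> Inl -` s}. Inr ` a p) \<union>
       (\<Union>q\<in>{q \<in> carrier Q. suppQ q \<subseteq> Inr -` s}. Inl ` b q)" for s
  have cF: "countable (F s)" if "finite s" for s
  proof -
    have "finite (Inl -` s :: 'i set)" "finite (Inr -` s :: 'j set)"
      using that by (simp_all add: finite_vimageI)
    then show ?thesis
      unfolding F_def
      using P.countable_conditions Q.countable_conditions a b by (intro countable_Un countable_UN) auto
  qed
  have "\<exists>T. countable T \<and> Inl ` W \<subseteq> T \<and> (\<forall>s. finite s \<and> s \<subseteq> T \<longrightarrow> F s \<subseteq> T)"
    by (intro countable_finitary_closure cF countable_image W)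
  then obtain T where T: "countable T" "Inl ` W \<subseteq> T"
    "\<And>s. finite s \<Longrightarrow> s \<subseteq> T \<Longrightarrow> F s \<subseteq> T"
    by metis
  show thesis
  proof (rule that[of "Inl -` T" "Inr -` T"])
    show "countable (Inl -` T :: 'i set)"
      by (rule countable_image_inj_on[of Inl]) (auto intro: countable_subset[OF _ T(1)])
    show "W \<subseteq> Inl -` T"
      using T(2) by blast
    show "Q.supports (Inr -` T) (f p)" if p: "p \<in> carrier P" "suppP p \<subseteq> Inl -` T" for p
    proof -
      have "Inr ` a p \<subseteq> F (Inl ` suppP p)"
        unfolding F_def using p(1) by (intro le_supI1 UN_upper) auto
      also have "\<dots> \<subseteq> T"
        using p P.finite_supp by (intro T(3)) auto
      finally have "a p \<subseteq> Inr -` T"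
        by auto
      then show ?thesis
        using Q.supports_mono assms(3) a p(1) by blast
    qed
    show "P.supports (Inl -` T) (g q)" if q: "q \<in> carrier Q" "suppQ q \<subseteq> Inr -` T" for q
    proof -
      have "Inl ` b q \<subseteq> F (Inr ` suppQ q)"
        unfolding F_def using q(1) by (intro le_supI2 UN_upper) auto
      also have "\<dots> \<subseteq> T"
        using q Q.finite_supp by (intro T(3)) auto
      finally have "b q \<subseteq> Inl -` T"
        by auto
      then show ?thesis
        using P.supports_mono assms(4) b q(1) by blast
    qed
  qed
qed

section \<open>Set mappings with countable values\<close>

text \<open>Choose \<open>A\<close> in \<open>X\<close> of size aleph_1. Its points and their values
  make up at most aleph_1 elements, so the bound aleph_2 leaves some \<open>y\<close> outside all of
  them; the countable \<open>F y\<close> cannot cover \<open>A\<close>, which yields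
  \<open>x\<close>.\<close>

lemma ex_free_pair:
  fixes X :: "'a set"
  assumes X: "cardSuc (cardSuc natLeq) \<le>o |X|" and F: "\<And>x. x \<in> X \<Longrightarrow> countable (F x)"
  obtains x y where "x \<in> X" "y \<in> X" "x \<noteq> y" "x \<notin> F y" "y \<notin> F x"
proof -
  note c1 = cardSuc_Card_order[OF natLeq_Card_order]
  have lt: "cardSuc natLeq <o |X|"
    using cardSuc_greater[OF c1] X by (rule ordLess_ordLeq_trans)
  have "|Field (cardSuc natLeq)| \<le>o |X|"
    using card_of_Field_ordIso[OF c1] ordLess_imp_ordLeq[OF lt] by (rule ordIso_ordLeq_trans)
  then obtain h where h: "inj_on h (Field (cardSuc natLeq))" "h ` Field (cardSuc natLeq) \<subseteq> X"
    unfolding card_of_ordLeq[symmetric] by blast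
  define A where "A = h ` Field (cardSuc natLeq)"
  have "|A| =o |Field (cardSuc natLeq)|"
    unfolding A_def using h(1)
    by (meson card_of_ordIso inj_on_imp_bij_betw ordIso_symmetric)
  then have A: "|A| =o cardSuc natLeq"
    using card_of_Field_ordIso[OF c1] by (rule ordIso_transitive)
  have unc: "\<not> countable A"
  proof
    assume "countable A"
    then have "|A| \<le>o natLeq"
      by (simp add: countable_card_le_natLeq)
    then have "cardSuc natLeq \<le>o natLeq"
      using ordIso_ordLeq_trans[OF ordIso_symmetric[OF A]] by blast
    then show False
      using cardSuc_greater[OF natLeq_Card_order] not_ordLess_ordLeq by blast
  qed
  have inf: "infinite A"
    using unc countable_finite by blast
  have "|F a| \<le>o |A|" if "a \<in> A" for a
  proof -
    have "|F a| \<le>o natLeq"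
      using F[of a] that h(2) unfolding A_def by (auto simp: countable_card_le_natLeq)
    then show ?thesis
      using inf infinite_iff_natLeq_ordLeq ordLeq_transitive by blast
  qed
  then have "|\<Union>a\<in>A. F a| \<le>o |A|"
    by (intro card_of_UNION_ordLeq_infinite[OF inf card_of_mono1[OF subset_refl]]) blast
  then have "|A \<union> (\<Union>a\<in>A. F a)| \<le>o |A|"
    using inf by (intro card_of_Un_ordLeq_infinite_Field card_of_Card_order card_of_mono1[OF subset_refl])
      (simp_all add: Field_card_of)
  then have "|A \<union> (\<Union>a\<in>A. F a)| <o |X|"
    using ordLeq_ordLess_trans[OF ordLeq_ordIso_trans[OF _ A] lt] by blast
  then have "\<not> X \<subseteq> A \<union> (\<Union>a\<in>A. F a)"
    using card_of_mono1 not_ordLess_ordLeq by blast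
  then obtain y where y: "y \<in> X" "y \<notin> A" "\<And>a. a \<in> A \<Longrightarrow> y \<notin> F a"
    by blast
  have "\<not> A \<subseteq> F y"
    using unc F[OF y(1)] countable_subset by blast
  then obtain x where "x \<in> A" "x \<notin> F y"
    by blast
  with y h(2) show thesis
    by (intro that[of x y]) (auto simp: A_def)
qed

section \<open>Free amalgamation of Cohen conditions and triangle-free graphs\<close>

text \<open>The amalgam is \<open>p ++ q\<close>: since \<open>q\<close> is defined only inside
  \<open>S\<close> and extends the trace of \<open>p\<close> on \<open>S\<close>, overwriting by
  \<open>q\<close> changes no value of \<open>p\<close>.\<close>

lemma restriction_system_cohen_forcing:
  "restriction_system (cohen_forcing Z) dom (\<lambda>S p. p |` S)"
proof -
  interpret partial_order "cohen_forcing Z"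
    by (rule partial_order_cohen_forcing)
  show ?thesis
  proof
    fix S :: "'a set" assume S: "finite S"
    have "finite (\<Union>D\<in>Pow S. {p :: 'a \<rightharpoonup> bool. dom p = D \<and> ran p \<subseteq> UNIV})"
      using S by (intro finite_UN_I finite_set_of_finite_maps) (auto intro: finite_subset)
    then show "countable {p \<in> carrier (cohen_forcing Z). dom p \<subseteq> S}"
      by (intro countable_finite) (auto elim: rev_finite_subset)
  next
    fix p q S
    assume p: "p \<in> carrier (cohen_forcing Z)" and q: "q \<in> carrier (cohen_forcing Z)"
      and S: "dom q \<subseteq> S" and le: "q \<sqsubseteq>\<^bsub>cohen_forcing Z\<^esub> p |` S"
    have "q \<subseteq>\<^sub>m p ++ q" "p ++ q \<in> carrier (cohen_forcing Z)"
      using p q by (auto simp: cohen_forcing_def)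
    moreover have "p \<subseteq>\<^sub>m p ++ q"
      unfolding map_le_def
    proof
      fix a assume a: "a \<in> dom p"
      show "p a = (p ++ q) a"
      proof (cases "a \<in> dom q")
        case True
        then have "a \<in> dom (p |` S)"
          using a S by auto
        then have "(p |` S) a = q a"
          using le unfolding cohen_forcing_def map_le_def by simp
        then show ?thesis
          using True S by (auto simp: map_add_dom_app_simps)
      qed (simp add: map_add_dom_app_simps)
    qed
    ultimately have "p ++ q \<in> carrier (cohen_forcing Z)"
      "p ++ q \<sqsubseteq>\<^bsub>cohen_forcing Z\<^esub> p" "p ++ q \<sqsubseteq>\<^bsub>cohen_forcing Z\<^esub> q"
      by (simp_all add: cohen_forcing_def)
    then show "\<exists>r\<in>carrier (cohen_forcing Z). r \<sqsubseteq>\<^bsub>cohen_forcing Z\<^esub> p \<and> r \<sqsubseteq>\<^bsub>cohen_forcing Z\<^esub> q"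
      by blast
  next
    fix p :: "'a \<rightharpoonup> bool" and S assume "dom p \<subseteq> S"
    then show "p |` S = p"
      by (intro ext) (metis domIff in_mono restrict_in restrict_out)
  qed (auto simp: cohen_forcing_def map_le_def subset_iff)
qed


section \<open>Induced subgraphs and free amalgams of triangle-free graphs\<close>

definition induced :: "'a set \<Rightarrow> 'a binstr \<Rightarrow> 'a binstr" where
  "induced S A = (fst A \<inter> S, snd A \<inter> S \<times> S)"

lemma fst_induced [simp]: "fst (induced S A) = fst A \<inter> S"
  and snd_induced [simp]: "snd (induced S A) = snd A \<inter> S \<times> S"
  by (simp_all add: induced_def)

abbreviation triangle_forcing :: "'a set \<Rightarrow> 'a binstr gorder" where
  "triangle_forcing X \<equiv> structure_forcing X \<K>\<^sub>\<triangle>"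

lemma triangle_forcing_carrier:
  "A \<in> carrier (triangle_forcing X) \<longleftrightarrow> fst A \<subseteq> X \<and> finite (fst A) \<and>
    snd A \<subseteq> fst A \<times> fst A \<and> sym (snd A) \<and> irrefl (snd A) \<and> triangle_free A"
  unfolding structure_forcing_def triangle_free_graphs_def is_graph_def by auto

lemma triangle_freeD:
  "triangle_free A \<Longrightarrow> (a, b) \<in> snd A \<Longrightarrow> (b, c) \<in> snd A \<Longrightarrow> (a, c) \<in> snd A \<Longrightarrow> False"
  unfolding triangle_free_def by blast

lemma triangle_forcing_le: "B \<sqsubseteq>\<^bsub>triangle_forcing X\<^esub> A \<longleftrightarrow> substructure A B"
  by (simp add: structure_forcing_def)

text \<open>This is the free amalgam. The vertex sets meet exactly in
  \<open>fst A \<inter> S\<close>, and there \<open>A\<close> and \<open>B\<close> have the same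
  edges, so neither graph gains an edge inside its own vertex set.\<close>

lemma substructure_union:
  assumes "is_graph A" "is_graph B" "fst B \<subseteq> S" "substructure (induced S A) B"
  shows "substructure A (fst A \<union> fst B, snd A \<union> snd B)"
    and "substructure B (fst A \<union> fst B, snd A \<union> snd B)"
proof -
  have AB: "snd A \<subseteq> fst A \<times> fst A" "snd B \<subseteq> fst B \<times> fst B"
    using assms(1,2) by (simp_all add: is_graph_def)
  have sub: "fst A \<inter> S \<subseteq> fst B" "snd A \<inter> S \<times> S = snd B \<inter> (fst A \<inter> S) \<times> (fst A \<inter> S)"
    using assms(4) by (simp_all add: substructure_def)
  have "snd A = (snd A \<union> snd B) \<inter> fst A \<times> fst A"
    using AB sub(2) assms(3) by blast
  then show "substructure A (fst A \<union> fst B, snd A \<union> snd B)"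
    by (simp add: substructure_def)
  have "snd B = (snd A \<union> snd B) \<inter> fst B \<times> fst B"
    using AB sub assms(3) by blast
  then show "substructure B (fst A \<union> fst B, snd A \<union> snd B)"
    by (simp add: substructure_def)
qed

text \<open>No edge of the amalgam joins the two private parts, so a triangle lies within one of the
  two vertex sets, and the substructure property returns it to \<open>A\<close> or
  \<open>B\<close>.\<close>

lemma triangle_free_union:
  assumes "is_graph A" "is_graph B" "triangle_free A" "triangle_free B"
    "fst B \<subseteq> S" "substructure (induced S A) B"
  shows "triangle_free (fst A \<union> fst B, snd A \<union> snd B)"
proof -
  let ?C = "(fst A \<union> fst B, snd A \<union> snd B)"
  note sub = substructure_union[OF assms(1,2,5,6)]
  have "False" if t: "(a, b) \<in> snd ?C" "(b, c) \<in> snd ?C" "(a, c) \<in> snd ?C" for a b c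
  proof -
    have both: "u \<in> fst A \<and> v \<in> fst A \<or> u \<in> fst B \<and> v \<in> fst B" if "(u, v) \<in> snd ?C" for u v
      using that assms(1,2) unfolding is_graph_def by auto
    then consider "{a, b, c} \<subseteq> fst A" | "{a, b, c} \<subseteq> fst B"
      using both[OF t(1)] both[OF t(2)] both[OF t(3)] by blast
    then show False
    proof cases
      case 1
      with t sub(1) have "(a, b) \<in> snd A" "(b, c) \<in> snd A" "(a, c) \<in> snd A"
        unfolding substructure_def by blast+
      with assms(3) show False
        unfolding triangle_free_def by blast
    next
      case 2
      with t sub(2) have "(a, b) \<in> snd B" "(b, c) \<in> snd B" "(a, c) \<in> snd B"
        unfolding substructure_def by blast+
      with assms(4) show False
        unfolding triangle_free_def by blast
    qed
  qed
  then show ?thesis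
    unfolding triangle_free_def by blast
qed

lemma partial_order_triangle_forcing: "partial_order (triangle_forcing X)"
  by (rule partial_order_structure_forcing) (auto simp: triangle_free_graphs_def)

lemma restriction_system_triangle_forcing:
  "restriction_system (triangle_forcing X) fst induced"
proof -
  interpret partial_order "triangle_forcing X"
    by (rule partial_order_triangle_forcing)
  show ?thesis
  proof
    fix S :: "'a set" assume S: "finite S"
    have "A \<in> Pow S \<times> Pow (S \<times> S)" if "A \<in> carrier (triangle_forcing X)" "fst A \<subseteq> S" for A
      using that unfolding triangle_forcing_carrier mem_Times_iff by blast
    then have "{A \<in> carrier (triangle_forcing X). fst A \<subseteq> S} \<subseteq> Pow S \<times> Pow (S \<times> S)"
      by blast
    moreover have "finite (Pow S \<times> Pow (S \<times> S))"
      using S by simp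
    ultimately show "countable {A \<in> carrier (triangle_forcing X). fst A \<subseteq> S}"
      by (meson countable_finite finite_subset)
  next
    fix A B :: "'a binstr" and S
    assume A: "A \<in> carrier (triangle_forcing X)" and B: "B \<in> carrier (triangle_forcing X)"
      and S: "fst B \<subseteq> S" and le: "B \<sqsubseteq>\<^bsub>triangle_forcing X\<^esub> induced S A"
    let ?C = "(fst A \<union> fst B, snd A \<union> snd B)"
    have K: "is_graph A" "is_graph B" "triangle_free A" "triangle_free B"
      using A B by (auto simp: structure_forcing_def triangle_free_graphs_def)
    have sub: "substructure (induced S A) B"
      using le by (simp add: triangle_forcing_le)
    have "is_graph ?C"
      using K(1,2) unfolding is_graph_def sym_def irrefl_def by auto
    moreover have "triangle_free ?C"
      by (rule triangle_free_union[OF K S sub])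
    ultimately have "?C \<in> carrier (triangle_forcing X)"
      using A B by (auto simp: structure_forcing_def triangle_free_graphs_def)
    with substructure_union[OF K(1,2) S sub]
    show "\<exists>C\<in>carrier (triangle_forcing X). C \<sqsubseteq>\<^bsub>triangle_forcing X\<^esub> A \<and> C \<sqsubseteq>\<^bsub>triangle_forcing X\<^esub> B"
      unfolding triangle_forcing_le by blast
  next
    fix A :: "'a binstr" and S
    assume A: "A \<in> carrier (triangle_forcing X)" and S: "fst A \<subseteq> S"
    have "snd A \<subseteq> fst A \<times> fst A"
      using A by (simp add: triangle_forcing_carrier)
    also have "\<dots> \<subseteq> S \<times> S"
      using S by (intro Sigma_mono)
    finally show "induced S A = A"
      using S by (simp add: prod_eq_iff Int_absorb2)
  next
    fix A :: "'a binstr" and S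
    assume A: "A \<in> carrier (triangle_forcing X)"
    then have "sym (snd (induced S A))" "irrefl (snd (induced S A))"
      by (auto simp: triangle_forcing_carrier sym_def irrefl_def)
    moreover have "triangle_free (induced S A)"
      using A unfolding triangle_forcing_carrier triangle_free_def snd_induced by blast
    moreover have "snd (induced S A) \<subseteq> fst (induced S A) \<times> fst (induced S A)"
      using A by (auto simp: triangle_forcing_carrier)
    ultimately show "induced S A \<in> carrier (triangle_forcing X)"
      using A unfolding triangle_forcing_carrier by auto
  qed (auto simp: triangle_forcing_carrier triangle_forcing_le substructure_def)
qed

section \<open>Edges and pendant vertices as conditions\<close>

text \<open>If extensions with the edge are dense below \<open>A\<close>, add \<open>x\<close> and
  \<open>y\<close> to the vertices of \<open>A\<close> without new edges. Extensions of this graph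
  add no edges between its vertices, so the edge was already in \<open>A\<close>.\<close>

lemma edge_in_RO: "{A \<in> carrier (triangle_forcing X). (x, y) \<in> snd A} \<in> RO (triangle_forcing X)"
  if xy: "x \<in> X" "y \<in> X"
proof -
  interpret forcing_notion "triangle_forcing X"
    by (simp add: forcing_notion_def partial_order_triangle_forcing)
  let ?E = "{A \<in> carrier (triangle_forcing X). (x, y) \<in> snd A}"
  have "(x, y) \<in> snd A" if A: "A \<in> carrier (triangle_forcing X)"
    and dense: "\<forall>B\<in>carrier (triangle_forcing X). B \<sqsubseteq>\<^bsub>triangle_forcing X\<^esub> A \<longrightarrow>
      (\<exists>C\<in>carrier (triangle_forcing X). C \<sqsubseteq>\<^bsub>triangle_forcing X\<^esub> B \<and> C \<in> ?E)" for A
  proof -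
    let ?B = "(insert x (insert y (fst A)), snd A)"
    have "?B \<in> carrier (triangle_forcing X)"
      using A xy unfolding triangle_forcing_carrier triangle_free_def by auto
    moreover have "?B \<sqsubseteq>\<^bsub>triangle_forcing X\<^esub> A"
      using A unfolding triangle_forcing_carrier triangle_forcing_le substructure_def by auto
    ultimately obtain C where "C \<sqsubseteq>\<^bsub>triangle_forcing X\<^esub> ?B" "(x, y) \<in> snd C"
      using dense by blast
    then show ?thesis
      by (simp add: triangle_forcing_le substructure_def)
  qed
  then show ?thesis
    unfolding mem_RO_iff by (auto simp: triangle_forcing_le substructure_def)
qed

definition pendant :: "'a \<Rightarrow> 'a \<Rightarrow> 'a binstr \<Rightarrow> 'a binstr" where
  "pendant x z A = (insert z (fst A), insert (x, z) (insert (z, x) (snd A)))"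

text \<open>The new vertex has degree one, so it lies on no triangle.\<close>

lemma pendant_closed:
  assumes "A \<in> carrier (triangle_forcing X)" "x \<in> fst A" "z \<in> X" "z \<notin> fst A"
  shows "pendant x z A \<in> carrier (triangle_forcing X)" "substructure A (pendant x z A)"
proof -
  have A: "snd A \<subseteq> fst A \<times> fst A" "sym (snd A)" "irrefl (snd A)" "triangle_free A"
    and fin: "fst A \<subseteq> X" "finite (fst A)"
    using assms(1) by (simp_all add: triangle_forcing_carrier)
  have z: "z \<noteq> x" "(u, z) \<notin> snd A" "(z, u) \<notin> snd A" "(u, u) \<notin> snd A" for u
    using A(1,3) assms(2,4) by (auto simp: irrefl_def)
  have "triangle_free (pendant x z A)"
    unfolding triangle_free_def pendant_def using z by (auto dest: triangle_freeD[OF A(4)])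
  moreover have "sym (snd (pendant x z A))"
    using A(2) unfolding pendant_def sym_def by auto
  moreover have "irrefl (snd (pendant x z A))"
    using z unfolding pendant_def irrefl_def by auto
  moreover have "snd (pendant x z A) \<subseteq> fst (pendant x z A) \<times> fst (pendant x z A)"
    using A(1) assms(2) unfolding pendant_def by auto
  ultimately show "pendant x z A \<in> carrier (triangle_forcing X)"
    using fin assms(3) unfolding triangle_forcing_carrier by (simp add: pendant_def)
  show "substructure A (pendant x z A)"
    using A(1) assms(4) unfolding substructure_def pendant_def by auto
qed

text \<open>Over a common vertex outside \<open>B\<close> the two traces of \<open>B\<close>, each with its pendant edge, still
  amalgamate once the edge \<open>xy\<close>, which neither trace sees, is erased.\<close>

lemma pendants_compatible:
  assumes B: "B \<in> carrier (triangle_forcing X)" and xy: "(x, y) \<in> snd B"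
    and z: "z \<in> X" "z \<notin> fst B"
    and "x \<in> S" "y \<notin> S" "y \<in> T" "x \<notin> T"
  obtains C where "C \<in> carrier (triangle_forcing X)"
    "substructure (pendant x z (induced S B)) C" "substructure (pendant y z (induced T B)) C"
proof
  let ?C = "(insert z (fst B), snd B - {(x, y), (y, x)} \<union> {(x, z), (z, x), (y, z), (z, y)})"
  have B': "snd B \<subseteq> fst B \<times> fst B" "sym (snd B)" "irrefl (snd B)" "triangle_free B"
    and fin: "fst B \<subseteq> X" "finite (fst B)"
    using B by (simp_all add: triangle_forcing_carrier)
  have irr: "(u, u) \<notin> snd B" and z': "(u, z) \<notin> snd B" "(z, u) \<notin> snd B" for u
    using B'(1,3) z(2) by (auto simp: irrefl_def)
  have mem: "u \<in> fst B" "v \<in> fst B" if "(u, v) \<in> snd B" for u v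
    using B'(1) that by auto
  have ne: "x \<noteq> y" "x \<in> fst B" "y \<in> fst B" "z \<noteq> x" "z \<noteq> y"
    using irr xy B'(1) z(2) by auto
  \<comment> \<open>The only neighbours of \<open>z\<close> are \<open>x\<close> and
    \<open>y\<close>, no longer adjacent, so no triangle passes through \<open>z\<close>.\<close>
  have "triangle_free ?C"
    unfolding triangle_free_def using irr z' ne by (auto dest: triangle_freeD[OF B'(4)])
  moreover have "sym (snd ?C)"
    using B'(2) unfolding sym_def by auto
  moreover have "irrefl (snd ?C)"
    using irr ne unfolding irrefl_def by auto
  moreover have "snd ?C \<subseteq> fst ?C \<times> fst ?C"
    using B'(1) ne by auto
  ultimately show "?C \<in> carrier (triangle_forcing X)"
    using fin z(1) unfolding triangle_forcing_carrier by simp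
  show "substructure (pendant x z (induced S B)) ?C"
    using z z' ne mem assms(5-8) unfolding substructure_def pendant_def by auto
  show "substructure (pendant y z (induced T B)) ?C"
    using z z' ne mem assms(5-8) unfolding substructure_def pendant_def by auto
qed

text \<open>The property of Cohen conditions that graphs lack: the traces on \<open>S\<close> and
  \<open>T\<close> together make up the trace on \<open>S \<union> T\<close>, whereas the traces of
  a graph miss the edges between \<open>S - T\<close> and \<open>T - S\<close>.\<close>

lemma restrict_map_Un_le:
  assumes "p |` S \<subseteq>\<^sub>m t" "p |` T \<subseteq>\<^sub>m t"
  shows "p |` (S \<union> T) \<subseteq>\<^sub>m t |` (S \<union> T)"
  unfolding map_le_def
proof
  fix a assume "a \<in> dom (p |` (S \<union> T))"
  then consider "a \<in> dom (p |` S)" "a \<in> S" | "a \<in> dom (p |` T)" "a \<in> T"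
    by auto
  then show "(p |` (S \<union> T)) a = (t |` (S \<union> T)) a"
  proof cases
    case 1
    then show ?thesis
      using bspec[OF assms(1)[unfolded map_le_def] 1(1)] by simp
  next
    case 2
    then show ?thesis
      using bspec[OF assms(2)[unfolded map_le_def] 2(1)] by simp
  qed
qed

section \<open>Incomparable supports with infinite intersection\<close>

lemma triangle_forcing_not_equivalent_cohen_forcing:
  fixes X :: "'a set" and Z :: "'b set"
  assumes X: "cardSuc (cardSuc natLeq) \<le>o |X|"
  shows "\<not> triangle_forcing X \<simeq>\<^sub>f cohen_forcing Z"
proof
  let ?P = "triangle_forcing X" and ?Q = "cohen_forcing Z"
  assume "?P \<simeq>\<^sub>f ?Q"
  then obtain f where iso: "RO_iso ?P ?Q f"
    unfolding forcing_equivalent_def by blast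
  interpret P: restriction_system ?P fst induced
    by (rule restriction_system_triangle_forcing)
  interpret Q: restriction_system ?Q dom "\<lambda>S p. p |` S"
    by (rule restriction_system_cohen_forcing)
  have bij: "bij_betw f (RO ?P) (RO ?Q)"
    and mono: "\<And>U V. U \<in> RO ?P \<Longrightarrow> V \<in> RO ?P \<Longrightarrow> f U \<subseteq> f V \<longleftrightarrow> U \<subseteq> V"
    using iso by (simp_all add: RO_iso_iff_order_iso)
  have fRO: "f U \<in> RO ?Q" if "U \<in> RO ?P" for U
    using bij that by (auto simp: bij_betw_def)
  define g where "g = inv_into (RO ?P) f"
  have gRO: "g V \<in> RO ?P" and fg: "f (g V) = V" if "V \<in> RO ?Q" for V
    using bij that unfolding g_def by (auto simp: bij_betw_def inv_into_into f_inv_into_f)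
  note Int = RO_iso_Int[OF iso] and empty = RO_iso_empty[OF iso]

  have inf: "infinite X"
  proof
    assume "finite X"
    then have "|X| <o natLeq"
      by (simp add: finite_iff_ordLess_natLeq)
    also have "natLeq <o cardSuc natLeq"
      by (rule cardSuc_greater[OF natLeq_Card_order])
    also have "cardSuc natLeq <o cardSuc (cardSuc natLeq)"
      by (intro cardSuc_greater cardSuc_Card_order natLeq_Card_order)
    finally show False
      using X not_ordLess_ordLeq by blast
  qed
  \<comment> \<open>Placing \<open>W\<close> in every \<open>Y x\<close> gives all these sets a
    common infinite part, from which a vertex outside any given finite graph can be drawn.\<close>
  obtain W where W: "countable W" "infinite W" "W \<subseteq> X"
    using infinite_countable_subset'[OF inf] by blast

  have "\<exists>Y S. countable Y \<and> insert x W \<subseteq> Y \<and>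
      (\<forall>p\<in>carrier ?P. fst p \<subseteq> Y \<longrightarrow> Q.supports S (f (P.cone p))) \<and>
      (\<forall>q\<in>carrier ?Q. dom q \<subseteq> S \<longrightarrow> P.supports Y (g (Q.cone q)))" for x
  proof -
    have "countable (insert x W)"
      using W(1) by simp
    from ex_matching_supports[OF P.restriction_system_axioms Q.restriction_system_axioms,
        of "\<lambda>p. f (P.cone p)" "\<lambda>q. g (Q.cone q)", OF _ _ this]
    show ?thesis
      using fRO[OF P.cone_in_RO] gRO[OF Q.cone_in_RO] by metis
  qed
  then obtain Y S where count: "\<And>x. countable (Y x)" and Y: "\<And>x. insert x W \<subseteq> Y x"
    and suppf: "\<And>x p. p \<in> carrier ?P \<Longrightarrow> fst p \<subseteq> Y x \<Longrightarrow> Q.supports (S x) (f (P.cone p))"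
    and suppg: "\<And>x q. q \<in> carrier ?Q \<Longrightarrow> dom q \<subseteq> S x \<Longrightarrow> P.supports (Y x) (g (Q.cone q))"
    by metis
  \<comment> \<open>Neither \<open>Y x\<close> nor \<open>Y y\<close> contains both \<open>x\<close>
    and \<open>y\<close>, so the edge \<open>xy\<close> is invisible to both traces.\<close>
  obtain x y where xy: "x \<in> X" "y \<in> X" "x \<noteq> y" "x \<notin> Y y" "y \<notin> Y x"
    using ex_free_pair[OF X count] .

  let ?E = "{A \<in> carrier ?P. (x, y) \<in> snd A}"
  note E = edge_in_RO[OF xy(1,2)]
  have "({x, y}, {(x, y), (y, x)}) \<in> ?E"
    using xy(1-3) by (auto simp: triangle_forcing_carrier sym_def irrefl_def triangle_free_def)
  then have "\<not> ?E \<subseteq> {}"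
    by blast
  then have "f ?E \<noteq> {}"
    using mono[OF E RO_empty] empty by simp
  \<comment> \<open>\<open>p\<close> forces the edge on the Cohen side. Pulling its hull back gives
    a graph \<open>B\<close> that contains \<open>xy\<close>.\<close>
  then obtain p where pE: "p \<in> f ?E"
    by blast
  then have p: "p \<in> carrier ?Q"
    using RO_D(3)[OF fRO[OF E]] by blast
  let ?V = "\<lambda>u. Q.cone (p |` S u)"
  have pu: "p |` S u \<in> carrier ?Q" for u
    using Q.res_closed[OF p] .
  have "f (g (Q.cone p)) \<noteq> f {}"
    using fg[OF Q.cone_in_RO[OF p]] Q.cone_self[OF p] empty by auto
  then obtain B where B: "B \<in> g (Q.cone p)"
    by fastforce
  have "g (Q.cone p) \<subseteq> ?E"
    using mono[OF gRO[OF Q.cone_in_RO[OF p]] E] fg[OF Q.cone_in_RO[OF p]]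
      Q.cone_subset[OF fRO[OF E] pE] by simp
  with B have BP: "B \<in> carrier ?P" and Bxy: "(x, y) \<in> snd B"
    by auto
  have "g (Q.cone p) \<subseteq> g (?V u)" for u
    using mono[OF gRO[OF Q.cone_in_RO[OF p]] gRO[OF Q.cone_in_RO[OF pu]]]
      fg[OF Q.cone_in_RO[OF p]] fg[OF Q.cone_in_RO[OF pu]] Q.cone_mono[OF p pu Q.le_res[OF p]]
    by simp
  \<comment> \<open>\<open>g (?V u)\<close> is supported by \<open>Y u\<close>, so the trace of
    \<open>B\<close> alone already forces the trace of \<open>p\<close> on
    \<open>S u\<close>.\<close>
  with B have B_trace: "induced (Y u) B \<in> g (?V u)" for u
    using suppg[OF pu, of u u] by (auto simp: P.supports_def)

  have "infinite (W - fst B)"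
    using W(2) P.finite_supp[OF BP] by simp
  then obtain z where z: "z \<in> W" "z \<notin> fst B"
    using infinite_imp_nonempty by blast
  have zX: "z \<in> X" and zY: "z \<in> Y u" for u
    using z W(3) Y[of u] by auto
  \<comment> \<open>\<open>N x\<close> and \<open>N y\<close> attach the same \<open>z\<close>:
    together with the edge \<open>xy\<close> they would contain a triangle.\<close>
  define N where "N u = pendant u z (induced (Y u) B)" for u
  have N: "N u \<in> carrier ?P" "substructure (induced (Y u) B) (N u)" if "u \<in> {x, y}" for u
    using pendant_closed[OF P.res_closed[OF BP], of u "Y u" z] that BP Bxy z zX Y[of u]
    unfolding N_def triangle_forcing_carrier by auto
  have fN: "f (P.cone (N u)) \<subseteq> ?V u" if "u \<in> {x, y}" for u
  proof -
    have "N u \<in> g (?V u)"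
      using P.RO_down[OF gRO[OF Q.cone_in_RO[OF pu]] B_trace] N[OF that]
      by (simp add: triangle_forcing_le)
    then have "P.cone (N u) \<subseteq> g (?V u)"
      by (rule P.cone_subset[OF gRO[OF Q.cone_in_RO[OF pu]]])
    then show ?thesis
      using mono[OF P.cone_in_RO[OF N(1)[OF that]] gRO[OF Q.cone_in_RO[OF pu]]]
        fg[OF Q.cone_in_RO[OF pu]] by simp
  qed
  \<comment> \<open>\<open>N u\<close> lives on \<open>Y u\<close>, since \<open>z\<close> comes
    from \<open>W\<close>; hence the image of its hull is supported by \<open>S u\<close>.\<close>
  have supN: "Q.supports (S u) (f (P.cone (N u)))" if "u \<in> {x, y}" for u
    using suppf[OF N(1)[OF that], of u] zY by (auto simp: N_def pendant_def)
  have NRO: "P.cone (N x) \<in> RO ?P" "P.cone (N y) \<in> RO ?P"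
    using P.cone_in_RO N(1) by auto

  obtain C where C: "C \<in> carrier ?P" "substructure (N x) C" "substructure (N y) C"
    using pendants_compatible[OF BP Bxy zX z(2), of "Y x" "Y y"] xy(4,5) Y unfolding N_def by blast
  then have "C \<in> P.cone (N x) \<inter> P.cone (N y)"
    using P.RO_down[OF NRO(1) P.cone_self] P.RO_down[OF NRO(2) P.cone_self] N(1)
    by (auto simp: triangle_forcing_le)
  then have "\<not> P.cone (N x) \<inter> P.cone (N y) \<subseteq> {}"
    by blast
  then have "f (P.cone (N x)) \<inter> f (P.cone (N y)) \<noteq> {}"
    using mono[OF RO_Int_closed[OF NRO] RO_empty] empty Int[OF NRO] by simp
  then obtain r where rx: "r \<in> f (P.cone (N x))" and ry: "r \<in> f (P.cone (N y))"
    by blast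
  then have r: "r \<in> carrier ?Q"
    using RO_D(3)[OF fRO[OF NRO(1)]] by blast
  \<comment> \<open>Both images are supported by \<open>?S\<close>, so \<open>r\<close> may be cut
    down to \<open>?S\<close>; otherwise it could conflict with \<open>p\<close> outside
    \<open>?S\<close>.\<close>
  let ?S = "S x \<union> S y"
  let ?r = "r |` ?S"
  have r': "?r \<in> carrier ?Q"
    by (rule Q.res_closed[OF r])
  have "Q.supports ?S (f (P.cone (N x)))" "Q.supports ?S (f (P.cone (N y)))"
    using Q.supports_mono fRO NRO supN by (meson Un_upper1 Un_upper2 insertCI)+
  then have rN: "?r \<in> f (P.cone (N x))" "?r \<in> f (P.cone (N y))"
    using rx ry by (auto simp: Q.supports_def)
  obtain s where s: "s \<in> carrier ?Q" "s \<sqsubseteq>\<^bsub>?Q\<^esub> ?r" "s \<sqsubseteq>\<^bsub>?Q\<^esub> p |` S x"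
    using Q.cone_refine[OF _ pu] fN[of x] rN(1) by blast
  have "s \<in> ?V y"
    using Q.RO_down[OF fRO[OF NRO(2)] rN(2) s(1,2)] fN[of y] by blast
  then obtain t where t: "t \<in> carrier ?Q" "t \<sqsubseteq>\<^bsub>?Q\<^esub> s" "t \<sqsubseteq>\<^bsub>?Q\<^esub> p |` S y"
    using Q.cone_refine[OF _ pu] by blast
  \<comment> \<open>The traces of \<open>p\<close> on \<open>S x\<close> and \<open>S y\<close>
    recombine, so \<open>t\<close> cut down to \<open>?S\<close> is compatible with \<open>p\<close>
    itself, and the common extension \<open>w\<close> forces the edge.\<close>
  have "t |` ?S \<sqsubseteq>\<^bsub>?Q\<^esub> p |` ?S"
    using restrict_map_Un_le[OF map_le_trans, of p "S x" s t "S y"] s(3) t(2,3)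
    by (simp add: cohen_forcing_def)
  then obtain w where w: "w \<in> carrier ?Q" "w \<sqsubseteq>\<^bsub>?Q\<^esub> p" "w \<sqsubseteq>\<^bsub>?Q\<^esub> t |` ?S"
    using Q.amalgamation[OF p Q.res_closed[OF t(1)] Q.supp_res[OF t(1)]] by blast
  have "t |` ?S \<sqsubseteq>\<^bsub>?Q\<^esub> ?r |` ?S"
    using Q.res_mono[OF r' t(1)] Q.le_trans[OF t(2) s(2) t(1) s(1) r'] by blast
  then have "w \<sqsubseteq>\<^bsub>?Q\<^esub> ?r"
    using Q.le_trans[OF w(3) _ w(1) Q.res_closed[OF t(1)] r'] by simp
  then have "w \<in> f (P.cone (N x)) \<inter> f (P.cone (N y)) \<inter> f ?E"
    using Q.RO_down[OF fRO[OF NRO(1)] rN(1) w(1)] Q.RO_down[OF fRO[OF NRO(2)] rN(2) w(1)]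
      Q.RO_down[OF fRO[OF E] pE w(1,2)] by blast
  then have "f (P.cone (N x) \<inter> P.cone (N y) \<inter> ?E) \<noteq> f {}"
    using Int[OF RO_Int_closed[OF NRO] E] Int[OF NRO] empty by auto
  then obtain A where A: "A \<in> P.cone (N x)" "A \<in> P.cone (N y)" "A \<in> ?E"
    by (metis (no_types, lifting) Int_iff ex_in_conv)
  \<comment> \<open>Membership in a hull gives only common extensions, so refining twice is what
    produces a single graph below \<open>A\<close>, \<open>N x\<close> and
    \<open>N y\<close>.\<close>
  obtain A1 where A1: "A1 \<in> carrier ?P" "A1 \<sqsubseteq>\<^bsub>?P\<^esub> A" "A1 \<sqsubseteq>\<^bsub>?P\<^esub> N x"
    using P.cone_refine[OF A(1)] N(1) by blast
  then obtain A2 where A2: "A2 \<in> carrier ?P" "A2 \<sqsubseteq>\<^bsub>?P\<^esub> A1" "A2 \<sqsubseteq>\<^bsub>?P\<^esub> N y"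
    using P.cone_refine[of A1 "N y"] P.RO_down[OF NRO(2) A(2)] N(1) by blast
  have "(x, z) \<in> snd (N x)" "(y, z) \<in> snd (N y)"
    by (simp_all add: N_def pendant_def)
  then have tri: "(x, y) \<in> snd A2" "(y, z) \<in> snd A2" "(x, z) \<in> snd A2"
    using A(3) A1(2,3) A2(2,3) by (auto simp: triangle_forcing_le substructure_def)
  then show False
    using triangle_freeD[OF _ tri] A2(1) by (simp add: triangle_forcing_carrier)
qed

text \<open>The index set \<open>Z\<close> of the preceding lemma ranges over sets of any type:
  \<open>Z = X\<close> settles the first claim, the infinite sets over \<open>'b\<close> the
  second.\<close>

theorem theorem1p1:
  fixes X :: "'a set"
  assumes "cardSuc (cardSuc natLeq) \<le>o |X|"
  shows "\<not> structure_forcing X \<K>\<^sub>\<triangle> \<simeq>\<^sub>f cohen_forcing X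
    \<and> \<not> is_cohen TYPE('b) (structure_forcing X \<K>\<^sub>\<triangle>)"
proof
  show "\<not> triangle_forcing X \<simeq>\<^sub>f cohen_forcing X"
    by (rule triangle_forcing_not_equivalent_cohen_forcing[OF assms])
  show "\<not> is_cohen TYPE('b) (triangle_forcing X)"
    unfolding is_cohen_def using triangle_forcing_not_equivalent_cohen_forcing[OF assms] by blast
qed

end
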